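(* Let $n$ be a positive integer. Consider any $A\in\mathrm{DSASM}(n)$, and let $U(A)$ be the sum of all strictly upper triangular entries in $A$ (or the sum of all strictly lower triangular entries in $A$), i.e., $U(A)=\sum_{1\le i<j\le n}A_{ij}$. Then $$U(A)+U(A^\ast)=n-1,$$ $$|U(A)-U(A^\dagger)|=1-\delta_{A,A^\dagger},$$ $$R(A)+R(A^\ast)\equiv n-1\pmod2,$$ and $$R(A)+R(A^\dagger)\equiv1-\delta_{A,A^\dagger}\pmod2.$$
   Context: An alternating sign matrix (ASM) is a square matrix with entries in $\{0,1,-1\}$ such that along each row and each column the nonzero entries alternate in sign and have sum $1$. $\mathrm{DSASM}(n)$ is the set of $n\times n$ ASMs equal to their transpose. $R(A)=\sum_{1\le i<j\le n}|A_{ij}|$ is the number of nonzero strictly upper triangular entries. $\delta$ is the Kronecker delta. Graph $\mathcal T_n$ (rows numbered downwards, columns rightwards): vertices are top vertices $(0,j)$, $1\le j\le n$; left boundary vertices $(i,i)$, $1\le i\le n$; bulk vertices $(i,j)$, $1\le i<j\le n$; right boundary vertices $(i,n+1)$, $1\le i\le n$. Edges are the vertical edges between $(i-1,j)$ and $(i,j)$ and the horizontal edges between $(i,j)$ and $(i,j+1)$, for $1\le i\le j\le n$. $\mathrm{6V}(n)$ is the set of orientations of the edges of $\mathcal T_n$ such that each bulk vertex has two incoming and two outgoing edges, each edge at a top vertex is directed upward, and each edge at a right boundary vertex is directed leftward. There is a bijection between $\mathrm{DSASM}(n)$ and $\mathrm{6V}(n)$ in which the DSASM $A$ corresponding to $C\in\mathrm{6V}(n)$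 is given, for $1\le i\le j\le n$, by: for $i<j$, $A_{ij}=A_{ji}=1$ if at $(i,j)$ both vertical edges are directed out of the vertex and both horizontal edges into it, $A_{ij}=A_{ji}=-1$ if both vertical edges are directed into the vertex and both horizontal edges out of it, and $A_{ij}=A_{ji}=0$ otherwise; $A_{ii}=1$ if at $(i,i)$ the upper edge points up and the right edge points left, $A_{ii}=-1$ if the upper edge points down and the right edge points right, and $A_{ii}=0$ otherwise. The involution $\ast$: for $n=1$ it is the identity. For $n\ge2$, if $A$ corresponds to $C$, then $A^\ast$ corresponds to $C^\ast$, obtained from $C$ by, for every $k=2,\ldots,n$, interchanging the orientations of the two edges which connect the superdiagonal vertex $(k-1,k)$ to $(k-1,k-1)$ and to $(k,k)$ (where an orientation is regarded as being into or out of $(k-1,k)$), leaving all other edges unchanged. The involution $\dagger$: if $A^\ast=A$ then $A^\dagger=A$. Otherwise, let $(k-1,k)$ be the first superdiagonal vertex (smallest $k$) at which, in the configuration $C$ corresponding to $A$, exactly one of the two edges connecting $(k-1,k)$ to $(k-1,k-1)$ and $(k,k)$ is directed into $(k-1,k)$; then $A^\dagger$ corresponds to the configuration obtained from $C$ by interchanging the orientations (into/out of $(k-1,k)$) of those two edges for this $k$ only, leaving all other edges unchanged. *)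

theory Defs
  imports "Jordan_Normal_Form.Matrix" "HOL-Number_Theory.Cong" "HOL-Combinatorics.Transposition"
begin

section \<open>Diagonally symmetric alternating sign matrices\<close>

text \<open>Matrices of type \<^typ>\<open>'a mat\<close> are indexed from 0; \<open>ent A i j\<close> is the entry in row \<open>i\<close> and
  column \<open>j\<close> counted from 1.\<close>

definition ent :: "int mat \<Rightarrow> nat \<Rightarrow> nat \<Rightarrow> int" where
  "ent A i j = A $$ (i - 1, j - 1)"

definition alternating :: "nat \<Rightarrow> (nat \<Rightarrow> int) \<Rightarrow> bool" where
  "alternating n f \<longleftrightarrow>
    (\<forall>j\<in>{1..n}. \<forall>j'\<in>{1..n}. j < j' \<and> f j \<noteq> 0 \<and> f j' \<noteq> 0 \<and> (\<forall>l. j < l \<and> l < j' \<longrightarrow> f l = 0)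
       \<longrightarrow> sgn (f j') = - sgn (f j))"

definition ASM :: "nat \<Rightarrow> int mat set" where
  "ASM n = {A \<in> carrier_mat n n.
     (\<forall>i\<in>{1..n}. \<forall>j\<in>{1..n}. ent A i j \<in> {0, 1, -1}) \<and>
     (\<forall>i\<in>{1..n}. alternating n (\<lambda>j. ent A i j) \<and> (\<Sum>j\<in>{1..n}. ent A i j) = 1) \<and>
     (\<forall>j\<in>{1..n}. alternating n (\<lambda>i. ent A i j) \<and> (\<Sum>i\<in>{1..n}. ent A i j) = 1)}"

definition DSASM :: "nat \<Rightarrow> int mat set" where
  "DSASM n = {A \<in> ASM n. transpose_mat A = A}"

definition U :: "nat \<Rightarrow> int mat \<Rightarrow> int" where
  "U n A = (\<Sum>(i, j)\<in>{(i, j). 1 \<le> i \<and> i < j \<and> j \<le> n}. ent A i j)"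

definition R :: "nat \<Rightarrow> int mat \<Rightarrow> int" where
  "R n A = (\<Sum>(i, j)\<in>{(i, j). 1 \<le> i \<and> i < j \<and> j \<le> n}. \<bar>ent A i j\<bar>)"

section \<open>Six-vertex configurations\<close>

type_synonym vertex = "nat \<times> nat"

definition edges :: "nat \<Rightarrow> vertex set set" where
  "edges n =
     {{(i - 1, j), (i, j)} | i j. 1 \<le> i \<and> i \<le> j \<and> j \<le> n} \<union>
     {{(i, j), (i, j + 1)} | i j. 1 \<le> i \<and> i \<le> j \<and> j \<le> n}"

text \<open>An orientation is the set of its arcs; \<open>(u, v)\<close> is the edge \<open>{u, v}\<close> directed from \<open>u\<close>
  to \<open>v\<close>.\<close>

type_synonym config = "(vertex \<times> vertex) set"

definition orientation :: "nat \<Rightarrow> config \<Rightarrow> bool" where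
  "orientation n C \<longleftrightarrow>
     (\<forall>(u, v)\<in>C. {u, v} \<in> edges n) \<and>
     (\<forall>u v. {u, v} \<in> edges n \<longrightarrow> ((u, v) \<in> C \<longleftrightarrow> (v, u) \<notin> C))"

definition sixV :: "nat \<Rightarrow> config set" where
  "sixV n = {C. orientation n C \<and>
     (\<forall>i j. 1 \<le> i \<and> i < j \<and> j \<le> n \<longrightarrow>
        card {u. (u, (i, j)) \<in> C} = 2 \<and> card {v. ((i, j), v) \<in> C} = 2) \<and>
     (\<forall>j\<in>{1..n}. ((1, j), (0, j)) \<in> C) \<and>
     (\<forall>i\<in>{1..n}. ((i, n + 1), (i, n)) \<in> C)}"

definition bulk_entry :: "config \<Rightarrow> nat \<Rightarrow> nat \<Rightarrow> int" where
  "bulk_entry C i j =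
    (if ((i, j), (i - 1, j)) \<in> C \<and> ((i, j), (i + 1, j)) \<in> C \<and>
        ((i, j - 1), (i, j)) \<in> C \<and> ((i, j + 1), (i, j)) \<in> C then 1
     else if ((i - 1, j), (i, j)) \<in> C \<and> ((i + 1, j), (i, j)) \<in> C \<and>
        ((i, j), (i, j - 1)) \<in> C \<and> ((i, j), (i, j + 1)) \<in> C then -1
     else 0)"

definition diag_entry :: "config \<Rightarrow> nat \<Rightarrow> int" where
  "diag_entry C i =
    (if ((i, i), (i - 1, i)) \<in> C \<and> ((i, i + 1), (i, i)) \<in> C then 1
     else if ((i - 1, i), (i, i)) \<in> C \<and> ((i, i), (i, i + 1)) \<in> C then -1
     else 0)"

definition matrix_of :: "nat \<Rightarrow> config \<Rightarrow> int mat" where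
  "matrix_of n C = mat n n (\<lambda>(r, c).
     let i = min r c + 1; j = max r c + 1
     in if i < j then bulk_entry C i j else diag_entry C i)"

text \<open>\<open>matrix_of n\<close> is a bijection from \<open>sixV n\<close> to \<open>DSASM n\<close>.\<close>

definition config_of :: "nat \<Rightarrow> int mat \<Rightarrow> config" where
  "config_of n = the_inv_into (sixV n) (matrix_of n)"

section \<open>The involutions\<close>

definition superdiag_arcs :: "nat \<Rightarrow> config" where
  "superdiag_arcs k =
     {((k - 1, k), (k - 1, k - 1)), ((k - 1, k - 1), (k - 1, k)),
      ((k - 1, k), (k, k)), ((k, k), (k - 1, k))}"

text \<open>Interchanging the orientations, relative to \<open>(k - 1, k)\<close>, of the edges joining it to
  \<open>(k - 1, k - 1)\<close> and \<open>(k, k)\<close> amounts to exchanging the names of these two neighbours in the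
  arcs concerned.\<close>

definition interchange :: "nat set \<Rightarrow> config \<Rightarrow> config" where
  "interchange K C =
     (C - (\<Union>k\<in>K. superdiag_arcs k)) \<union>
     (\<Union>k\<in>K. (let t = Transposition.transpose (k - 1, k - 1) (k, k)
              in map_prod t t ` (C \<inter> superdiag_arcs k)))"

definition star :: "nat \<Rightarrow> int mat \<Rightarrow> int mat" where
  "star n A = (if n = 1 then A else matrix_of n (interchange {2..n} (config_of n A)))"

definition unequal_at :: "config \<Rightarrow> nat \<Rightarrow> bool" where
  "unequal_at C k \<longleftrightarrow>
     (((k - 1, k - 1), (k - 1, k)) \<in> C) \<noteq> (((k, k), (k - 1, k)) \<in> C)"

definition dagger :: "nat \<Rightarrow> int mat \<Rightarrow> int mat" where
  "dagger n A =
    (if star n A = A then A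
     else let C = config_of n A; k = (LEAST k. 2 \<le> k \<and> k \<le> n \<and> unequal_at C k)
          in matrix_of n (interchange {k} C))"

end

theory Submission imports Defs begin

text \<open>
  An orientation of the graph is recorded by two truth values per cell: whether the vertical edge
  above \<open>(i, j)\<close> points up (\<open>v i j\<close>), and whether the horizontal edge to its right points left
  (\<open>h i j\<close>). In these terms the rule that each bulk vertex has two incoming and two outgoing edges
  says, with truth values read as \<open>0\<close> and \<open>1\<close>, that
  \<open>v i j - v (i + 1) j = h i j - h i (j - 1)\<close>, and the common value is the matrix entry
  (\<open>bulk_entry_arrows\<close>). Telescoping along a column and along a row, with the boundary edges known,
  yields \<open>v i j\<close> and \<open>h i j\<close> as complements of partial sums of entries
  (\<open>column_partial_sum\<close>, \<open>row_partial_sum\<close>). This determines the configuration from the matrix;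
  conversely, the partial sums of an alternating sign sequence are \<open>0\<close> or \<open>1\<close>
  (\<open>alternating_prefix_sum\<close>), so every symmetric alternating sign matrix comes from a configuration
  (\<open>DSASM_arrows\<close>).

  Full telescoping down to the diagonal expresses \<open>U\<close> in two ways: as the number of \<open>k\<close> in
  \<open>{2..n}\<close> whose vertical edge at \<open>(k, k)\<close> points down, and as the number of those \<open>k\<close> whose
  horizontal edge at \<open>(k - 1, k - 1)\<close> points right (\<open>U_arrows\<close>). These are the two edges which the
  involutions exchange; the exchange replaces \<open>v k k\<close> by the negation of \<open>h (k - 1) (k - 1)\<close> and
  vice versa (\<open>interchange_arrows\<close>), and it preserves the ice rule. After interchanging for all
  \<open>k\<close>, the count of downward vertical edges is the count of leftward horizontal edges before, which
  is \<open>n - 1 - U\<close> for the original matrix. Interchanging at one \<open>k\<close> where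
  exactly one of the two edges enters \<open>(k - 1, k)\<close> alters exactly one summand of \<open>U\<close>, by \<open>1\<close>. The
  congruences for \<open>R\<close> follow, because an integer and its absolute value have the same parity.
\<close>

section \<open>Orientations as pairs of edge functions\<close>

text \<open>\<open>v i j\<close> is the upward direction of the edge above \<open>(i, j)\<close> and \<open>h i j\<close> the leftward direction
  of the edge to its right. Each edge has exactly one such name, and the fixed boundary edges are
  those with \<open>v = True\<close> in row 1 and \<open>h = True\<close> in column \<open>n\<close>.\<close>

definition arrows :: "nat \<Rightarrow> (nat \<Rightarrow> nat \<Rightarrow> bool) \<Rightarrow> (nat \<Rightarrow> nat \<Rightarrow> bool) \<Rightarrow> config" where
  "arrows n v h = {(p, q). \<exists>i j. 1 \<le> i \<and> i \<le> j \<and> j \<le> n \<and>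
     (p = (i, j) \<and> q = (i - 1, j) \<and> v i j \<or>
      p = (i - 1, j) \<and> q = (i, j) \<and> \<not> v i j \<or>
      p = (i, j + 1) \<and> q = (i, j) \<and> h i j \<or>
      p = (i, j) \<and> q = (i, j + 1) \<and> \<not> h i j)}"

definition ice_rule :: "nat \<Rightarrow> (nat \<Rightarrow> nat \<Rightarrow> bool) \<Rightarrow> (nat \<Rightarrow> nat \<Rightarrow> bool) \<Rightarrow> bool" where
  "ice_rule n v h \<longleftrightarrow>
     (\<forall>i j. 1 \<le> i \<and> i < j \<and> j \<le> n \<longrightarrow>
        of_bool (v i j) - of_bool (v (i + 1) j) = (of_bool (h i j) - of_bool (h i (j - 1)) :: int)) \<and>
     (\<forall>j\<in>{1..n}. v 1 j) \<and> (\<forall>i\<in>{1..n}. h i n)"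

lemma ice_rule_flow:
  assumes "ice_rule n v h" "1 \<le> i" "i < j" "j \<le> n"
  shows "of_bool (v i j) - of_bool (v (i + 1) j) = (of_bool (h i j) - of_bool (h i (j - 1)) :: int)"
  using assms by (simp add: ice_rule_def)

lemma arrows_up:
  assumes "1 \<le> i" "i \<le> j" "j \<le> n"
  shows "((i, j), (i - 1, j)) \<in> arrows n v h \<longleftrightarrow> v i j"
  using assms by (auto simp: arrows_def)

lemma arrows_down:
  assumes "1 \<le> i" "i \<le> j" "j \<le> n"
  shows "((i - 1, j), (i, j)) \<in> arrows n v h \<longleftrightarrow> \<not> v i j"
  using assms by (auto simp: arrows_def)

lemma arrows_left:
  assumes "1 \<le> i" "i \<le> j" "j \<le> n"
  shows "((i, j + 1), (i, j)) \<in> arrows n v h \<longleftrightarrow> h i j"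
  using assms by (auto simp: arrows_def)

lemma arrows_right:
  assumes "1 \<le> i" "i \<le> j" "j \<le> n"
  shows "((i, j), (i, j + 1)) \<in> arrows n v h \<longleftrightarrow> \<not> h i j"
  using assms by (auto simp: arrows_def)

lemmas arrows_at = arrows_up arrows_down arrows_left arrows_right

text \<open>Whether a given arc belongs to an orientation depends only on the value of the edge function at
  the name of this one edge.\<close>

lemma arrows_transfer:
  assumes x: "x \<in> arrows n v h"
    and v: "\<And>i j. x = ((i, j), (i - 1, j)) \<or> x = ((i - 1, j), (i, j)) \<Longrightarrow> v' i j = v i j"
    and h: "\<And>i j. x = ((i, j + 1), (i, j)) \<or> x = ((i, j), (i, j + 1)) \<Longrightarrow> h' i j = h i j"
  shows "x \<in> arrows n v' h'"
proof -
  obtain i j where ij: "1 \<le> i" "i \<le> j" "j \<le> n"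
    and "x = ((i, j), (i - 1, j)) \<and> v i j \<or> x = ((i - 1, j), (i, j)) \<and> \<not> v i j \<or>
         x = ((i, j + 1), (i, j)) \<and> h i j \<or> x = ((i, j), (i, j + 1)) \<and> \<not> h i j"
    using x unfolding arrows_def by blast
  then consider "x = ((i, j), (i - 1, j))" "v i j" | "x = ((i - 1, j), (i, j))" "\<not> v i j"
    | "x = ((i, j + 1), (i, j))" "h i j" | "x = ((i, j), (i, j + 1))" "\<not> h i j" by blast
  then show ?thesis
    by cases (use v[of i j] h[of i j] in \<open>simp_all only: arrows_at[OF ij] simp_thms\<close>)
qed

lemma arrows_cong:
  assumes "\<And>i j. 1 \<le> i \<Longrightarrow> i \<le> j \<Longrightarrow> j \<le> n \<Longrightarrow> v i j = v' i j \<and> h i j = h' i j"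
  shows "arrows n v h = arrows n v' h'"
  unfolding arrows_def using assms by blast

lemma edge_cases:
  "{p, q} \<in> edges n \<longleftrightarrow> (\<exists>i j. 1 \<le> i \<and> i \<le> j \<and> j \<le> n \<and>
     (p = (i, j) \<and> q = (i - 1, j) \<or> p = (i - 1, j) \<and> q = (i, j) \<or>
      p = (i, j + 1) \<and> q = (i, j) \<or> p = (i, j) \<and> q = (i, j + 1)))"
  unfolding edges_def by (simp add: doubleton_eq_iff) blast

lemma orientation_arrows: "orientation n (arrows n v h)"
proof -
  have "(p, q) \<in> arrows n v h \<longleftrightarrow> (q, p) \<notin> arrows n v h" if edge: "{p, q} \<in> edges n" for p q
  proof -
    obtain i j where ij: "1 \<le> i" "i \<le> j" "j \<le> n"
      and c: "p = (i, j) \<and> q = (i - 1, j) \<or> p = (i - 1, j) \<and> q = (i, j) \<or>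
              p = (i, j + 1) \<and> q = (i, j) \<or> p = (i, j) \<and> q = (i, j + 1)"
      using edge unfolding edge_cases by blast
    from c show ?thesis using arrows_at[OF ij] by metis
  qed
  moreover have "{p, q} \<in> edges n" if "(p, q) \<in> arrows n v h" for p q
    using that unfolding edge_cases arrows_def by blast
  ultimately show ?thesis unfolding orientation_def by blast
qed

lemma orientation_imp_arrows:
  assumes "orientation n C"
  shows "C = arrows n (\<lambda>i j. ((i, j), (i - 1, j)) \<in> C) (\<lambda>i j. ((i, j + 1), (i, j)) \<in> C)"
proof -
  have e: "{p, q} \<in> edges n" if "(p, q) \<in> C" for p q
    using assms that unfolding orientation_def by blast
  have r: "(p, q) \<in> C \<longleftrightarrow> (q, p) \<notin> C" if "{p, q} \<in> edges n" for p q
    using assms that unfolding orientation_def by blast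
  let ?A = "arrows n (\<lambda>i j. ((i, j), (i - 1, j)) \<in> C) (\<lambda>i j. ((i, j + 1), (i, j)) \<in> C)"
  have "(p, q) \<in> C \<longleftrightarrow> (p, q) \<in> ?A" if edge: "{p, q} \<in> edges n" for p q
  proof -
    obtain i j where ij: "1 \<le> i" "i \<le> j" "j \<le> n"
      and c: "p = (i, j) \<and> q = (i - 1, j) \<or> p = (i - 1, j) \<and> q = (i, j) \<or>
              p = (i, j + 1) \<and> q = (i, j) \<or> p = (i, j) \<and> q = (i, j + 1)"
      using edge unfolding edge_cases by blast
    from c show ?thesis
      using r[OF edge] by (elim disjE conjE) (simp_all only: arrows_at[OF ij])
  qed
  moreover have "{p, q} \<in> edges n" if "(p, q) \<in> ?A" for p q
    using that orientation_arrows unfolding orientation_def by blast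
  ultimately show ?thesis using e by (intro equalityI subrelI) blast+
qed

lemma bulk_arcs:
  assumes "1 \<le> i" "i < j" "j \<le> n"
  shows "((i, j), (i - 1, j)) \<in> arrows n v h \<longleftrightarrow> v i j"
    "((i - 1, j), (i, j)) \<in> arrows n v h \<longleftrightarrow> \<not> v i j"
    "((i + 1, j), (i, j)) \<in> arrows n v h \<longleftrightarrow> v (i + 1) j"
    "((i, j), (i + 1, j)) \<in> arrows n v h \<longleftrightarrow> \<not> v (i + 1) j"
    "((i, j + 1), (i, j)) \<in> arrows n v h \<longleftrightarrow> h i j"
    "((i, j), (i, j + 1)) \<in> arrows n v h \<longleftrightarrow> \<not> h i j"
    "((i, j), (i, j - 1)) \<in> arrows n v h \<longleftrightarrow> h i (j - 1)"
    "((i, j - 1), (i, j)) \<in> arrows n v h \<longleftrightarrow> \<not> h i (j - 1)"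
  using assms arrows_at[of i j n v h] arrows_at(1,2)[of "i + 1" j n v h]
    arrows_at(3,4)[of i "j - 1" n v h]
  by simp_all

lemma bulk_neighbours:
  assumes "{p, (i, j)} \<in> edges n" "1 \<le> i" "i < j"
  shows "p \<in> {(i - 1, j), (i + 1, j), (i, j + 1), (i, j - 1)}"
  using assms unfolding edge_cases by auto

text \<open>The four neighbours of a bulk vertex are distinct, so its in-degree is the sum of four truth
  values; fixing this sum at two is the ice rule.\<close>

lemma arrows_bulk_degrees:
  assumes "1 \<le> i" "i < j" "j \<le> n"
  shows "card {u. (u, (i, j)) \<in> arrows n v h} = 2 \<and> card {w. ((i, j), w) \<in> arrows n v h} = 2 \<longleftrightarrow>
    of_bool (v i j) - of_bool (v (i + 1) j) = (of_bool (h i j) - of_bool (h i (j - 1)) :: int)"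
proof -
  have "{p, q} \<in> edges n" if "(p, q) \<in> arrows n v h" for p q
    using that orientation_arrows unfolding orientation_def by blast
  then have near: "u \<in> {(i - 1, j), (i + 1, j), (i, j + 1), (i, j - 1)}"
    if "(u, (i, j)) \<in> arrows n v h \<or> ((i, j), u) \<in> arrows n v h" for u
    using that bulk_neighbours[of u i j n] assms by (metis insert_commute)
  have "{u. (u, (i, j)) \<in> arrows n v h} =
      (if v i j then {} else {(i - 1, j)}) \<union> (if v (i + 1) j then {(i + 1, j)} else {}) \<union>
      (if h i j then {(i, j + 1)} else {}) \<union> (if h i (j - 1) then {} else {(i, j - 1)})"
    (is "?I = ?I'")
  proof (rule Set.set_eqI)
    show "u \<in> ?I \<longleftrightarrow> u \<in> ?I'" for u
      using near[of u] bulk_arcs[OF assms, of v h] by auto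
  qed
  moreover have "{w. ((i, j), w) \<in> arrows n v h} =
      (if v i j then {(i - 1, j)} else {}) \<union> (if v (i + 1) j then {} else {(i + 1, j)}) \<union>
      (if h i j then {} else {(i, j + 1)}) \<union> (if h i (j - 1) then {(i, j - 1)} else {})"
    (is "?O = ?O'")
  proof (rule Set.set_eqI)
    show "u \<in> ?O \<longleftrightarrow> u \<in> ?O'" for u
      using near[of u] bulk_arcs[OF assms, of v h] by auto
  qed
  moreover have "i - 1 \<noteq> i" "i - 1 \<noteq> i + 1" "j - 1 \<noteq> j" "j - 1 \<noteq> j + 1" using assms by auto
  ultimately show ?thesis
    by (cases "v i j"; cases "v (i + 1) j"; cases "h i j"; cases "h i (j - 1)")
      (simp_all del: One_nat_def add: card_insert_if)
qed

lemma arrows_in_sixV_iff: "arrows n v h \<in> sixV n \<longleftrightarrow> ice_rule n v h"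
proof -
  have "(\<forall>j\<in>{1..n}. ((1, j), (0, j)) \<in> arrows n v h) \<longleftrightarrow> (\<forall>j\<in>{1..n}. v 1 j)"
    using arrows_up[of 1] by force
  moreover have "(\<forall>i\<in>{1..n}. ((i, n + 1), (i, n)) \<in> arrows n v h) \<longleftrightarrow> (\<forall>i\<in>{1..n}. h i n)"
    using arrows_left[of _ n] by force
  ultimately show ?thesis
    unfolding sixV_def ice_rule_def using orientation_arrows arrows_bulk_degrees by auto
qed

lemma sixV_cases:
  assumes "C \<in> sixV n"
  obtains v h where "C = arrows n v h" "ice_rule n v h"
proof -
  have "orientation n C" using assms by (simp add: sixV_def)
  note C = orientation_imp_arrows[OF this]
  show ?thesis
    by (rule that[OF C]) (unfold arrows_in_sixV_iff[symmetric] C[symmetric], rule assms)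
qed

section \<open>Matrix entries as differences of edge functions\<close>

text \<open>Of the six local configurations allowed by the ice rule, the two in which the vertical edges
  disagree are those with entries \<open>1\<close> and \<open>-1\<close>; in the other four both differences vanish.\<close>

lemma bulk_entry_arrows:
  assumes ice: "ice_rule n v h" and "1 \<le> i" "i < j" "j \<le> n"
  shows "bulk_entry (arrows n v h) i j = of_bool (v i j) - of_bool (v (i + 1) j)"
    and "bulk_entry (arrows n v h) i j = of_bool (h i j) - of_bool (h i (j - 1))"
proof -
  note flow = ice_rule_flow[OF assms]
  show "bulk_entry (arrows n v h) i j = of_bool (v i j) - of_bool (v (i + 1) j)"
    "bulk_entry (arrows n v h) i j = of_bool (h i j) - of_bool (h i (j - 1))"
    using flow unfolding bulk_entry_def bulk_arcs[OF assms(2-)] by (auto simp: of_bool_def split: if_splits)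
qed

lemma diag_entry_arrows:
  assumes "1 \<le> i" "i \<le> n"
  shows "diag_entry (arrows n v h) i = of_bool (v i i) + of_bool (h i i) - 1"
  unfolding diag_entry_def using assms by (simp only: arrows_at order_refl) auto

lemma ent_matrix_of:
  assumes "1 \<le> i" "i \<le> j" "j \<le> n"
  shows "ent (matrix_of n C) i j = (if i < j then bulk_entry C i j else diag_entry C i)"
proof -
  have "i - 1 < n" "j - 1 < n" using assms by auto
  moreover have "min (i - 1) (j - 1) + 1 = i" "max (i - 1) (j - 1) + 1 = j" using assms by auto
  ultimately show ?thesis by (simp only: ent_def matrix_of_def index_mat case_prod_conv Let_def)
qed

text \<open>Both telescoping sums start at a boundary edge, where \<open>v 1 j\<close> and \<open>h i n\<close> are true; they stop
  strictly before the diagonal entry, to which the two differences do not apply.\<close>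

lemma column_partial_sum:
  assumes "ice_rule n v h" "1 \<le> i" "i \<le> j" "j \<le> n"
  shows "(\<Sum>l\<in>{1..<i}. ent (matrix_of n (arrows n v h)) l j) = 1 - of_bool (v i j)"
  using assms(2,3)
proof (induction i rule: dec_induct)
  case base
  then show ?case using assms by (auto simp: ice_rule_def)
next
  case (step i)
  then show ?case
    using assms bulk_entry_arrows(1)[OF assms(1), of i j] by (simp add: ent_matrix_of)
qed

lemma row_partial_sum:
  assumes "ice_rule n v h" "1 \<le> i" "i \<le> j" "j \<le> n"
  shows "(\<Sum>l\<in>{j<..n}. ent (matrix_of n (arrows n v h)) i l) = 1 - of_bool (h i j)"
  using assms(4,3)
proof (induction j rule: inc_induct)
  case base
  then show ?case using assms by (auto simp: ice_rule_def)
next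
  case (step j)
  have "{j<..n} = insert (Suc j) {Suc j<..n}" using step by auto
  then show ?case
    using step assms bulk_entry_arrows(2)[OF assms(1), of i "Suc j"] by (simp add: ent_matrix_of)
qed

section \<open>Matrices and configurations correspond\<close>

text \<open>The inverse of \<open>matrix_of\<close>, read off from the two partial sum formulas.\<close>

definition prefix_config :: "nat \<Rightarrow> int mat \<Rightarrow> config" where
  "prefix_config n A = arrows n (\<lambda>i j. (\<Sum>l\<in>{1..<i}. ent A l j) = 0)
     (\<lambda>i j. (\<Sum>l\<in>{j<..n}. ent A i l) = 0)"

lemma prefix_config_matrix_of:
  assumes "C \<in> sixV n"
  shows "prefix_config n (matrix_of n C) = C"
proof -
  obtain v h where C: "C = arrows n v h" "ice_rule n v h" using sixV_cases[OF assms] .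
  show ?thesis unfolding prefix_config_def C(1)
    by (rule arrows_cong) (simp del: One_nat_def add: column_partial_sum[OF C(2)] row_partial_sum[OF C(2)])
qed

text \<open>By alternation, the sum over a block is \<open>0\<close> or equal to the last nonzero term of the block:
  a further nonzero term has the opposite sign and exchanges the two possibilities.\<close>

lemma alternating_block_sum:
  fixes f :: "nat \<Rightarrow> int"
  assumes alt: "alternating n f" and f: "\<And>j. j \<in> {1..n} \<Longrightarrow> f j \<in> {0, 1, -1}" and "1 \<le> i" "k \<le> n"
  shows "\<bar>\<Sum>l\<in>{i..k}. f l\<bar> \<le> 1"
proof -
  have block: "(\<forall>l\<in>{i..k}. f l = 0) \<or>
      (\<exists>p\<in>{i..k}. f p \<noteq> 0 \<and> (\<forall>l. p < l \<and> l \<le> k \<longrightarrow> f l = 0) \<and> (\<Sum>l\<in>{i..k}. f l) \<in> {0, f p})"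
    using assms(4)
  proof (induction k)
    case 0
    then show ?case using assms by auto
  next
    case (Suc k)
    show ?case
    proof (cases "Suc k < i")
      case True
      then show ?thesis by auto
    next
      case False
      then have S: "(\<Sum>l\<in>{i..Suc k}. f l) = (\<Sum>l\<in>{i..k}. f l) + f (Suc k)"
        and set: "{i..Suc k} = insert (Suc k) {i..k}" by auto
      have "(\<forall>l\<in>{i..k}. f l = 0) \<or>
          (\<exists>p\<in>{i..k}. f p \<noteq> 0 \<and> (\<forall>l. p < l \<and> l \<le> k \<longrightarrow> f l = 0) \<and> (\<Sum>l\<in>{i..k}. f l) \<in> {0, f p})"
        using Suc by simp
      then consider (zero) "\<forall>l\<in>{i..k}. f l = 0"
        | (last) p where "p \<in> {i..k}" "f p \<noteq> 0" "\<forall>l. p < l \<and> l \<le> k \<longrightarrow> f l = 0"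
            "(\<Sum>l\<in>{i..k}. f l) \<in> {0, f p}"
        by meson
      then show ?thesis
      proof cases
        case zero
        then have sum0: "(\<Sum>l\<in>{i..k}. f l) = 0" by (simp add: sum.neutral)
        show ?thesis
        proof (cases "f (Suc k) = 0")
          case True
          then show ?thesis using zero by (intro disjI1) (simp add: set)
        next
          case nonzero: False
          then show ?thesis using sum0 False S
            by (intro disjI2 bexI[of _ "Suc k"]) auto
        qed
      next
        case last
        show ?thesis
        proof (cases "f (Suc k) = 0")
          case True
          then have "\<forall>l. p < l \<and> l \<le> Suc k \<longrightarrow> f l = 0" using last(3) by (auto simp: le_Suc_eq)
          then show ?thesis using last True S by (intro disjI2 bexI[of _ p]) auto
        next
          case nonzero: False
          have in_range: "p \<in> {1..n}" "Suc k \<in> {1..n}" "p < Suc k"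
            using last(1) Suc.prems assms(3) by auto
          then have "sgn (f (Suc k)) = - sgn (f p)"
            using alt last(2,3) nonzero unfolding alternating_def by (simp add: less_Suc_eq_le)
          then have "f (Suc k) = - f p" using f[OF in_range(1)] f[OF in_range(2)] by auto
          then show ?thesis using last S nonzero False by (intro disjI2 bexI[of _ "Suc k"]) auto
        qed
      qed
    qed
  qed
  then show ?thesis
  proof
    assume "\<forall>l\<in>{i..k}. f l = 0"
    then show ?thesis by (simp add: sum.neutral)
  next
    assume "\<exists>p\<in>{i..k}. f p \<noteq> 0 \<and> (\<forall>l. p < l \<and> l \<le> k \<longrightarrow> f l = 0) \<and> (\<Sum>l\<in>{i..k}. f l) \<in> {0, f p}"
    then obtain p where p: "p \<in> {i..k}" "(\<Sum>l\<in>{i..k}. f l) \<in> {0, f p}" by blast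
    moreover have "f p \<in> {0, 1, -1}" using p(1) assms(3,4) by (intro f) auto
    ultimately show ?thesis by auto
  qed
qed

text \<open>A prefix and the complementary suffix add up to \<open>1\<close>, and neither exceeds \<open>1\<close>.\<close>

lemma alternating_prefix_sum:
  fixes f :: "nat \<Rightarrow> int"
  assumes "alternating n f" "\<And>j. j \<in> {1..n} \<Longrightarrow> f j \<in> {0, 1, -1}"
    and total: "(\<Sum>j\<in>{1..n}. f j) = 1" and "k \<le> n"
  shows "(\<Sum>l\<in>{1..k}. f l) \<in> {0, 1}" and "(\<Sum>l\<in>{k<..n}. f l) \<in> {0, 1}"
proof -
  have "{1..n} = {1..k} \<union> {k<..n}" using assms(4) by auto
  then have "(\<Sum>l\<in>{1..k}. f l) + (\<Sum>l\<in>{k<..n}. f l) = 1"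
    using total by (simp add: sum.union_disjoint ivl_disj_int)
  moreover have "\<bar>\<Sum>l\<in>{1..k}. f l\<bar> \<le> 1"
    using alternating_block_sum[OF assms(1,2)] assms(4) by blast
  moreover have "\<bar>\<Sum>l\<in>{k<..n}. f l\<bar> \<le> 1"
    using alternating_block_sum[OF assms(1,2), of "Suc k" n] by (simp add: atLeastSucAtMost_greaterThanAtMost)
  ultimately show "(\<Sum>l\<in>{1..k}. f l) \<in> {0, 1}" "(\<Sum>l\<in>{k<..n}. f l) \<in> {0, 1}" by auto
qed

lemma DSASM_ent_sym:
  assumes "A \<in> DSASM n" "i \<in> {1..n}" "j \<in> {1..n}"
  shows "ent A i j = ent A j i"
proof -
  have A: "A \<in> carrier_mat n n" "transpose_mat A = A" using assms by (auto simp: DSASM_def ASM_def)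
  have "transpose_mat A $$ (i - 1, j - 1) = A $$ (j - 1, i - 1)"
    using A(1) assms by (intro index_transpose_mat) auto
  then show ?thesis using A(2) by (simp add: ent_def)
qed

text \<open>The partial sums are \<open>0\<close> or \<open>1\<close>, so nothing is lost in replacing them by truth values, and
  their differences give back the entries above the diagonal. On the diagonal, symmetry turns the
  column sum above \<open>(i, i)\<close> into the part of row \<open>i\<close> left of it, and the full row sum \<open>1\<close> yields the
  entry.\<close>

lemma DSASM_arrows:
  assumes A: "A \<in> DSASM n"
  shows "prefix_config n A \<in> sixV n" and "matrix_of n (prefix_config n A) = A"
proof -
  let ?v = "\<lambda>i j. (\<Sum>l\<in>{1..<i}. ent A l j) = 0"
  let ?h = "\<lambda>i j. (\<Sum>l\<in>{j<..n}. ent A i l) = 0"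
  have carrier: "A \<in> carrier_mat n n"
    and entries: "\<And>i j. i \<in> {1..n} \<Longrightarrow> j \<in> {1..n} \<Longrightarrow> ent A i j \<in> {0, 1, -1}"
    and rows: "\<And>i. i \<in> {1..n} \<Longrightarrow> alternating n (\<lambda>j. ent A i j)"
      "\<And>i. i \<in> {1..n} \<Longrightarrow> (\<Sum>j\<in>{1..n}. ent A i j) = 1"
    and cols: "\<And>j. j \<in> {1..n} \<Longrightarrow> alternating n (\<lambda>i. ent A i j)"
      "\<And>j. j \<in> {1..n} \<Longrightarrow> (\<Sum>i\<in>{1..n}. ent A i j) = 1"
    using A unfolding DSASM_def ASM_def by blast+
  have v: "of_bool (?v i j) = 1 - (\<Sum>l\<in>{1..<i}. ent A l j)" if "1 \<le> i" "i \<le> j" "j \<le> n" for i j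
  proof -
    have "(\<Sum>l\<in>{1..i - 1}. ent A l j) \<in> {0, 1}"
      using that by (intro alternating_prefix_sum(1)[where n = n] cols entries) auto
    moreover have "{1..i - 1} = {1..<i}" using that by auto
    ultimately show ?thesis by auto
  qed
  have h: "of_bool (?h i j) = 1 - (\<Sum>l\<in>{j<..n}. ent A i l)" if "1 \<le> i" "i \<le> j" "j \<le> n" for i j
  proof -
    have "(\<Sum>l\<in>{j<..n}. ent A i l) \<in> {0, 1}"
      using that by (intro alternating_prefix_sum(2)[where n = n] rows entries) auto
    then show ?thesis by auto
  qed
  have v_diff: "of_bool (?v i j) - of_bool (?v (i + 1) j) = ent A i j"
    if "1 \<le> i" "i < j" "j \<le> n" for i j
    using that v[of i j] v[of "i + 1" j] by simp
  have h_diff: "of_bool (?h i j) - of_bool (?h i (j - 1)) = ent A i j"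
    if "1 \<le> i" "i < j" "j \<le> n" for i j
  proof -
    have "{j - 1<..n} = insert j {j<..n}" using that by auto
    then show ?thesis using that h[of i j] h[of i "j - 1"] by simp
  qed
  have ice: "ice_rule n ?v ?h" unfolding ice_rule_def using v_diff h_diff by simp
  then show "prefix_config n A \<in> sixV n" unfolding prefix_config_def arrows_in_sixV_iff .
  have diag: "diag_entry (prefix_config n A) i = ent A i i" if i: "1 \<le> i" "i \<le> n" for i
  proof -
    have "{1..n} = {1..<i} \<union> insert i {i<..n}" using i by auto
    moreover have "{1..<i} \<inter> {i<..n} = {}" by auto
    ultimately have "(\<Sum>l\<in>{1..n}. ent A i l) =
        (\<Sum>l\<in>{1..<i}. ent A i l) + (ent A i i + (\<Sum>l\<in>{i<..n}. ent A i l))"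
      by (simp add: sum.union_disjoint del: One_nat_def)
    moreover have "(\<Sum>l\<in>{1..<i}. ent A i l) = (\<Sum>l\<in>{1..<i}. ent A l i)"
      using i by (intro sum.cong refl DSASM_ent_sym[OF A]) auto
    ultimately show ?thesis
      unfolding prefix_config_def using i rows(2)[of i] v[of i i] h[of i i]
      by (simp add: diag_entry_arrows)
  qed
  have upper: "ent (matrix_of n (prefix_config n A)) i j = ent A i j"
    if "1 \<le> i" "i \<le> j" "j \<le> n" for i j
  proof (cases "i < j")
    case True
    then show ?thesis
      using that v_diff[of i j] bulk_entry_arrows(1)[OF ice, of i j]
      by (simp add: ent_matrix_of prefix_config_def)
  next
    case False
    then show ?thesis using that diag[of i] by (simp add: ent_matrix_of)
  qed
  show "matrix_of n (prefix_config n A) = A"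
  proof (rule eq_matI)
    fix r c assume "r < dim_row A" "c < dim_col A"
    then have rc: "r < n" "c < n" using carrier by auto
    let ?i = "min r c + 1" and ?j = "max r c + 1"
    have "matrix_of n (prefix_config n A) $$ (r, c) = ent (matrix_of n (prefix_config n A)) ?i ?j"
      using rc by (simp add: ent_def matrix_of_def Let_def)
    also have "\<dots> = ent A ?i ?j" using rc by (intro upper) auto
    also have "\<dots> = ent A (r + 1) (c + 1)"
      using DSASM_ent_sym[OF A, of "r + 1" "c + 1"] rc by (auto simp: min_def max_def)
    finally show "matrix_of n (prefix_config n A) $$ (r, c) = A $$ (r, c)" by (simp add: ent_def)
  qed (use carrier in \<open>auto simp: matrix_of_def\<close>)
qed

lemma DSASM_cases:
  assumes "A \<in> DSASM n"
  obtains v h where "ice_rule n v h" "A = matrix_of n (arrows n v h)" "config_of n A = arrows n v h"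
proof -
  have "inj_on (matrix_of n) (sixV n)"
    by (rule inj_on_inverseI[where g = "prefix_config n"]) (rule prefix_config_matrix_of)
  then have "config_of n A = prefix_config n A"
    unfolding config_of_def using DSASM_arrows[OF assms] by (metis the_inv_into_f_f)
  then show ?thesis
    using that DSASM_arrows[OF assms] sixV_cases[of "prefix_config n A" n] by metis
qed

section \<open>Effect of an interchange\<close>

lemma image_of_involution_iff:
  assumes "\<And>x. f (f x) = x" "\<And>x. x \<in> S \<Longrightarrow> f x \<in> S"
  shows "x \<in> f ` (C \<inter> S) \<longleftrightarrow> x \<in> S \<and> f x \<in> C"
proof
  assume "x \<in> S \<and> f x \<in> C"
  then show "x \<in> f ` (C \<inter> S)" using assms by (intro image_eqI[of _ _ "f x"]) simp_all
qed (use assms in auto)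

text \<open>The edge from \<open>(k - 1, k - 1)\<close> enters \<open>(k - 1, k)\<close> when it points right, the edge from \<open>(k, k)\<close>
  when it points up. Exchanging the two orientations therefore exchanges \<open>v k k\<close> with the negation
  of \<open>h (k - 1) (k - 1)\<close>. The arcs concerned are different for different \<open>k\<close>, so the exchanges do not
  interfere.\<close>

lemma interchange_arrows:
  assumes K: "K \<subseteq> {2..n}"
  shows "interchange K (arrows n v h) =
    arrows n (\<lambda>i j. if i = j \<and> i \<in> K then \<not> h (i - 1) (i - 1) else v i j)
      (\<lambda>i j. if i = j \<and> Suc i \<in> K then \<not> v (Suc i) (Suc i) else h i j)"
    (is "_ = arrows n ?v ?h")
proof -
  let ?C = "arrows n v h"
  let ?t = "\<lambda>k::nat. Transposition.transpose (k - 1, k - 1) (k, k)"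
  have involution: "map_prod (?t k) (?t k) (map_prod (?t k) (?t k) x) = x" for k x
    by (cases x) simp
  have arcs_mapped: "map_prod (?t k) (?t k) x \<in> superdiag_arcs k"
    if "2 \<le> k" "x \<in> superdiag_arcs k" for k x
    using that by (cases k) (auto simp: superdiag_arcs_def Transposition.transpose_def)
  have mem: "x \<in> interchange K ?C \<longleftrightarrow>
      x \<in> ?C \<and> x \<notin> (\<Union>k\<in>K. superdiag_arcs k) \<or>
      (\<exists>k\<in>K. x \<in> superdiag_arcs k \<and> map_prod (?t k) (?t k) x \<in> ?C)" for x
  proof -
    have "x \<in> map_prod (?t k) (?t k) ` (?C \<inter> superdiag_arcs k) \<longleftrightarrow>
        x \<in> superdiag_arcs k \<and> map_prod (?t k) (?t k) x \<in> ?C" if "k \<in> K" for k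
      using that K by (intro image_of_involution_iff involution arcs_mapped) auto
    then show ?thesis
      unfolding interchange_def Let_def Un_iff Diff_iff UN_iff by (simp cong: bex_cong)
  qed
  have at_k: "x \<in> interchange K ?C \<longleftrightarrow> x \<in> arrows n ?v ?h"
    if k: "k \<in> K" "x \<in> superdiag_arcs k" for k x
  proof -
    have k2: "2 \<le> k" "k \<le> n" using k K by auto
    have "k' = k" if "k' \<in> K" "x \<in> superdiag_arcs k'" for k'
    proof -
      have "k' \<noteq> 0" "k \<noteq> 0" using that k K by auto
      then show ?thesis
        using that(2) k(2) by (cases k; cases k') (auto simp: superdiag_arcs_def)
    qed
    then have "x \<in> interchange K ?C \<longleftrightarrow> map_prod (?t k) (?t k) x \<in> ?C"
      using mem[of x] k by blast
    moreover have "((k - 1, k), (k - 1, k - 1)) \<in> arrows n v' h' \<longleftrightarrow> h' (k - 1) (k - 1)"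
      "((k - 1, k - 1), (k - 1, k)) \<in> arrows n v' h' \<longleftrightarrow> \<not> h' (k - 1) (k - 1)"
      "((k - 1, k), (k, k)) \<in> arrows n v' h' \<longleftrightarrow> \<not> v' k k"
      "((k, k), (k - 1, k)) \<in> arrows n v' h' \<longleftrightarrow> v' k k" for v' h'
      using k2 arrows_at(3,4)[of "k - 1" "k - 1" n v' h'] arrows_at(1,2)[of k k n v' h'] by simp_all
    ultimately show ?thesis
      using k k2 by (cases k) (auto simp: superdiag_arcs_def Transposition.transpose_def)
  qed
  have away: "x \<in> interchange K ?C \<longleftrightarrow> x \<in> arrows n ?v ?h"
    if x: "x \<notin> (\<Union>k\<in>K. superdiag_arcs k)" for x
  proof -
    have v: "?v i j = v i j" if "x = ((i, j), (i - 1, j)) \<or> x = ((i - 1, j), (i, j))" for i j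
      using that x unfolding superdiag_arcs_def by auto
    have h: "?h i j = h i j" if "x = ((i, j + 1), (i, j)) \<or> x = ((i, j), (i, j + 1))" for i j
      using that x unfolding superdiag_arcs_def by force
    have "x \<in> ?C \<longleftrightarrow> x \<in> arrows n ?v ?h"
    proof
      show "x \<in> arrows n ?v ?h" if "x \<in> ?C" using that by (rule arrows_transfer) (fact v h)+
      show "x \<in> ?C" if "x \<in> arrows n ?v ?h"
        using that by (rule arrows_transfer) (fact v[symmetric] h[symmetric])+
    qed
    then show ?thesis using mem[of x] x by blast
  qed
  show ?thesis using at_k away by blast
qed

text \<open>At \<open>(k - 1, k)\<close> the rule fixes the number of incoming edges, to which the two exchanged edges
  contribute the same in total.\<close>

lemma ice_rule_interchange:
  assumes K: "K \<subseteq> {2..n}" and ice: "ice_rule n v h"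
  shows "ice_rule n (\<lambda>i j. if i = j \<and> i \<in> K then \<not> h (i - 1) (i - 1) else v i j)
      (\<lambda>i j. if i = j \<and> Suc i \<in> K then \<not> v (Suc i) (Suc i) else h i j)"
    (is "ice_rule n ?v ?h")
proof -
  note flow = ice_rule_flow[OF ice]
  have "of_bool (?v i j) - of_bool (?v (i + 1) j) =
      (of_bool (?h i j) - of_bool (?h i (j - 1)) :: int)" if ij: "1 \<le> i" "i < j" "j \<le> n" for i j
  proof (cases "j = i + 1")
    case True
    then show ?thesis using ij flow[of i j] by (auto simp: of_bool_def split: if_splits)
  next
    case False
    then show ?thesis using ij flow[of i j] by auto
  qed
  moreover have "1 \<notin> K" "Suc n \<notin> K" using K by auto
  ultimately show ?thesis using ice unfolding ice_rule_def by auto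
qed

text \<open>Summing the entries above the diagonal by columns, respectively by rows, telescopes each column
  or row completely. The row formula is indexed by \<open>k = i + 1\<close>, so that the two edges incident to
  \<open>(k - 1, k)\<close> share an index.\<close>

lemma U_arrows:
  assumes ice: "ice_rule n v h"
  shows "U n (matrix_of n (arrows n v h)) = (\<Sum>k\<in>{2..n}. of_bool (\<not> v k k))"
    and "U n (matrix_of n (arrows n v h)) = (\<Sum>k\<in>{2..n}. of_bool (\<not> h (k - 1) (k - 1)))"
proof -
  let ?a = "ent (matrix_of n (arrows n v h))"
  have "{(i, j). 1 \<le> i \<and> i < j \<and> j \<le> n} = (\<lambda>(j, i). (i, j)) ` (SIGMA j:{2..n}. {1..<j})"
    by (auto simp: image_iff)
  then have "U n (matrix_of n (arrows n v h)) = (\<Sum>(j, i)\<in>(SIGMA j:{2..n}. {1..<j}). ?a i j)"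
    unfolding U_def by (simp add: sum.reindex inj_on_def case_prod_unfold)
  also have "\<dots> = (\<Sum>j\<in>{2..n}. \<Sum>i\<in>{1..<j}. ?a i j)" by (simp add: sum.Sigma)
  also have "\<dots> = (\<Sum>k\<in>{2..n}. of_bool (\<not> v k k))"
    by (intro sum.cong refl) (simp add: column_partial_sum[OF ice] of_bool_def del: One_nat_def)
  finally show "U n (matrix_of n (arrows n v h)) = (\<Sum>k\<in>{2..n}. of_bool (\<not> v k k))" .
  have "{(i, j). 1 \<le> i \<and> i < j \<and> j \<le> n} = (\<lambda>(k, j). (k - 1, j)) ` (SIGMA k:{2..n}. {k - 1<..n})"
  proof (intro subset_antisym subsetI)
    fix x assume "x \<in> {(i, j). 1 \<le> i \<and> i < j \<and> j \<le> n}"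
    then obtain i j where "x = (i, j)" "1 \<le> i" "i < j" "j \<le> n" by auto
    then show "x \<in> (\<lambda>(k, j). (k - 1, j)) ` (SIGMA k:{2..n}. {k - 1<..n})"
      by (intro image_eqI[of _ _ "(Suc i, j)"]) auto
  qed auto
  moreover have "inj_on (\<lambda>(k, j). (k - 1, j)) (SIGMA k:{2..n}. {k - 1<..n})"
    by (auto simp: inj_on_def)
  ultimately have "U n (matrix_of n (arrows n v h)) =
      (\<Sum>(k, j)\<in>(SIGMA k:{2..n}. {k - 1<..n}). ?a (k - 1) j)"
    unfolding U_def by (simp add: sum.reindex case_prod_unfold)
  also have "\<dots> = (\<Sum>k\<in>{2..n}. \<Sum>j\<in>{k - 1<..n}. ?a (k - 1) j)" by (simp add: sum.Sigma)
  also have "\<dots> = (\<Sum>k\<in>{2..n}. of_bool (\<not> h (k - 1) (k - 1)))"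
    by (intro sum.cong refl) (subst row_partial_sum[OF ice], auto simp: of_bool_def)
  finally show "U n (matrix_of n (arrows n v h)) = (\<Sum>k\<in>{2..n}. of_bool (\<not> h (k - 1) (k - 1)))" .
qed

lemma U_interchange:
  assumes K: "K \<subseteq> {2..n}" and ice: "ice_rule n v h"
  shows "U n (matrix_of n (interchange K (arrows n v h))) =
    (\<Sum>k\<in>{2..n}. if k \<in> K then of_bool (h (k - 1) (k - 1)) else of_bool (\<not> v k k))"
  unfolding interchange_arrows[OF K] U_arrows(1)[OF ice_rule_interchange[OF assms]]
  by (intro sum.cong refl) auto

lemma unequal_at_arrows:
  assumes "2 \<le> k" "k \<le> n"
  shows "unequal_at (arrows n v h) k \<longleftrightarrow> h (k - 1) (k - 1) = v k k"
  using assms arrows_right[of "k - 1" "k - 1" n v h] arrows_up[of k k n v h]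
  unfolding unequal_at_def by auto

lemma interchange_trivial:
  assumes "\<And>k. k \<in> {2..n} \<Longrightarrow> \<not> unequal_at (arrows n v h) k"
  shows "interchange {2..n} (arrows n v h) = arrows n v h"
  unfolding interchange_arrows[OF order_refl]
proof (rule arrows_cong)
  fix i j assume ij: "1 \<le> i" "i \<le> j" "j \<le> n"
  have opposite: "h (k - 1) (k - 1) \<longleftrightarrow> \<not> v k k" if "k \<in> {2..n}" for k
    using assms[OF that] that unequal_at_arrows[of k n v h] by auto
  show "(if i = j \<and> i \<in> {2..n} then \<not> h (i - 1) (i - 1) else v i j) = v i j \<and>
      (if i = j \<and> Suc i \<in> {2..n} then \<not> v (Suc i) (Suc i) else h i j) = h i j"
    using opposite[of i] opposite[of "Suc i"] by auto
qed

section \<open>The two involutions\<close>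

text \<open>For \<open>n = 1\<close> there is no superdiagonal vertex, so the separate clause for this case agrees with
  the general one.\<close>

lemma star_eq_interchange:
  assumes "A \<in> DSASM n"
  shows "star n A = matrix_of n (interchange {2..n} (config_of n A))"
proof (cases "n = 1")
  case True
  then have "interchange {2..n} C = C" for C by (simp add: interchange_def)
  then show ?thesis using True DSASM_cases[OF assms] by (metis star_def)
qed (simp add: star_def)

text \<open>Counting \<open>U\<close> before the interchange by horizontal edges and after it by vertical edges, each \<open>k\<close>
  in \<open>{2..n}\<close> is counted exactly once.\<close>

lemma U_star:
  assumes "n \<ge> 1" "A \<in> DSASM n"
  shows "U n A + U n (star n A) = int n - 1"
proof -
  obtain v h where ice: "ice_rule n v h" and A: "A = matrix_of n (arrows n v h)"
    and C: "config_of n A = arrows n v h" using DSASM_cases[OF assms(2)] .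
  have "U n A + U n (star n A) =
      (\<Sum>k\<in>{2..n}. of_bool (\<not> h (k - 1) (k - 1)) + of_bool (h (k - 1) (k - 1)))"
    unfolding star_eq_interchange[OF assms(2)] C U_interchange[OF order_refl ice]
    unfolding A U_arrows(2)[OF ice] sum.distrib by simp
  also have "\<dots> = (\<Sum>k\<in>{2..n}. 1)" by (intro sum.cong) auto
  finally show ?thesis using assms(1) by simp
qed

text \<open>If at every superdiagonal vertex the two edges both enter or both leave, then interchanging
  everywhere is trivial and \<open>A\<close> is fixed by \<open>star\<close>. Otherwise the interchange at an unequal vertex changes one summand of
  \<open>U\<close>; this also shows that the matrix changes.\<close>

lemma U_dagger:
  assumes "A \<in> DSASM n"
  shows "\<bar>U n A - U n (dagger n A)\<bar> = 1 - of_bool (A = dagger n A)"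
proof (cases "star n A = A")
  case True
  then show ?thesis by (simp add: dagger_def)
next
  case False
  obtain v h where ice: "ice_rule n v h" and A: "A = matrix_of n (arrows n v h)"
    and C: "config_of n A = arrows n v h" using DSASM_cases[OF assms] .
  define k where "k = (LEAST k. 2 \<le> k \<and> k \<le> n \<and> unequal_at (arrows n v h) k)"
  have ex: "\<exists>k. 2 \<le> k \<and> k \<le> n \<and> unequal_at (arrows n v h) k"
  proof (rule ccontr)
    assume "\<not> ?thesis"
    then have "interchange {2..n} (arrows n v h) = arrows n v h"
      by (intro interchange_trivial) auto
    then show False using False star_eq_interchange[OF assms] A C by simp
  qed
  then have k: "2 \<le> k" "k \<le> n" "unequal_at (arrows n v h) k"
    using LeastI_ex[OF ex] unfolding k_def by blast+
  have dagger: "dagger n A = matrix_of n (interchange {k} (arrows n v h))"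
    using False C by (simp add: dagger_def Let_def k_def)
  have K: "{k} \<subseteq> {2..n}" using k by simp
  have "U n A - U n (dagger n A) =
      (\<Sum>l\<in>{2..n}. if l = k then of_bool (\<not> v k k) - of_bool (h (k - 1) (k - 1)) else 0)"
    unfolding dagger U_interchange[OF K ice]
    unfolding A U_arrows(1)[OF ice] sum_subtractf[symmetric] by (intro sum.cong) auto
  also have "\<dots> = of_bool (\<not> v k k) - of_bool (h (k - 1) (k - 1))" using k by simp
  finally have "\<bar>U n A - U n (dagger n A)\<bar> = 1"
    using unequal_at_arrows[OF k(1,2)] k(3) by (auto simp: of_bool_def)
  moreover from this have "A \<noteq> dagger n A" by auto
  ultimately show ?thesis by simp
qed

lemma R_cong_U: "[R n A = U n A] (mod 2)"
  unfolding R_def U_def by (intro cong_sum) (auto simp: cong_iff_dvd_diff abs_if split: if_splits)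

theorem proposition9p1:
  fixes n :: nat and A :: "int mat"
  assumes "n \<ge> 1" and "A \<in> DSASM n"
  shows "U n A + U n (star n A) = int n - 1 \<and>
    \<bar>U n A - U n (dagger n A)\<bar> = 1 - of_bool (A = dagger n A) \<and>
    [R n A + R n (star n A) = int n - 1] (mod 2) \<and>
    [R n A + R n (dagger n A) = 1 - of_bool (A = dagger n A)] (mod 2)"
proof (intro conjI)
  show star: "U n A + U n (star n A) = int n - 1" using U_star[OF assms] .
  show dagger: "\<bar>U n A - U n (dagger n A)\<bar> = 1 - of_bool (A = dagger n A)"
    using U_dagger[OF assms(2)] .
  show "[R n A + R n (star n A) = int n - 1] (mod 2)"
    unfolding star[symmetric] by (intro cong_add R_cong_U)
  have "[R n A + R n (dagger n A) = U n A + U n (dagger n A)] (mod 2)"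
    by (intro cong_add R_cong_U)
  also have "[U n A + U n (dagger n A) = \<bar>U n A - U n (dagger n A)\<bar>] (mod 2)"
    by (auto simp: cong_iff_dvd_diff abs_if)
  finally show "[R n A + R n (dagger n A) = 1 - of_bool (A = dagger n A)] (mod 2)"
    unfolding dagger .
qed

end
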